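(* A Nash equilibrium (in behavioral strategies) exists in the game $\mathsf G^{\mathrm{special}}$ with complete information on one side and partial information on the other (defined in the context).
   Context: $\Delta\mathcal A$ is the probability simplex over a finite set $\mathcal A$; $X_{a:b}=(X_a,\dots,X_b)$. **Game $\mathsf G^{\mathrm{special}}$.** Fix a horizon $T$ and finite sets $\mathcal X_t$ (states), $\mathcal U_t^1,\mathcal U_t^2$ (actions), $\mathcal Y_t^2$ (observations of player 2). The state evolves as $X_{t+1}=f_t(X_t,U_t^1,U_t^2,W_t^s)$, and player 2 gets the observation $Y_t^2=h_t^2(X_t,U_{t-1}^1,U_{t-1}^2,W_t^2)$ (no action arguments at $t=1$). The random variables $X_1,W_t^s,W_t^2$ take finitely many values and are mutually independent. At time $t$ player 1 knows $I_t^1=\{X_{1:t},Y_{1:t}^2,U_{1:t-1}^1,U_{1:t-1}^2\}$ and player 2 knows $I_t^2=\{Y_{1:t}^2,U_{1:t-1}^2\}$. A behavioral strategy of player $i$ is $g^i=(g_1^i,\dots,g_T^i)$, where $g_t^i$ maps realizations of $I_t^i$ to $\Delta\mathcal U_t^i$; the action $U_t^i$ is drawn from $g_t^i(I_t^i)$, using randomizations independent across players and time and independent of $X_1,W_t^s,W_t^2$. The cost is $J(g^1,g^2)=\mathbb E^{(g^1,g^2)}[\sum_{t=1}^Tc_t(X_t,U_t^1,U_t^2)]$ with $c_t:\mathcal X_t\times\mathcal U_t^1\times\mathcal U_t^2\to\mathbb R$; player 1 minimizes, player 2 maximizes. A Nash equilibrium is a strategy profile $(g^{1*},g^{2*})$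 with $J(g^{1*},g^2)\le J(g^{1*},g^{2*})\le J(g^1,g^{2*})$ for all strategies $g^1,g^2$. *)

theory Defs
  imports "HOL-Probability.Probability"
begin

text \<open>
  Time runs over \<open>{1..horizon G}\<close>; the fields are only relevant at these times. The carriers
  at different times may be different finite subsets of a common type. The basic random variables
  \<open>X\<^sub>1\<close>, \<open>W\<^sub>t\<^sup>s\<close>, \<open>W\<^sub>t\<^sup>2\<close> are
  given by their laws \<open>init\<close>, \<open>state_noise t\<close>, \<open>obs_noise t\<close>. The first
  observation takes no action arguments, so it has its own map \<open>obs_init\<close>; \<open>obs t\<close>
  is used for \<open>t \<ge> 2\<close>.
\<close>

record ('x, 'u1, 'u2, 'y, 'ws, 'wo) game =
  horizon :: nat
  states :: "nat \<Rightarrow> 'x set"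
  actions1 :: "nat \<Rightarrow> 'u1 set"
  actions2 :: "nat \<Rightarrow> 'u2 set"
  observations :: "nat \<Rightarrow> 'y set"
  init :: "'x pmf"
  state_noise :: "nat \<Rightarrow> 'ws pmf"
  obs_noise :: "nat \<Rightarrow> 'wo pmf"
  trans_map :: "nat \<Rightarrow> 'x \<Rightarrow> 'u1 \<Rightarrow> 'u2 \<Rightarrow> 'ws \<Rightarrow> 'x"
  obs_init :: "'x \<Rightarrow> 'wo \<Rightarrow> 'y"
  obs :: "nat \<Rightarrow> 'x \<Rightarrow> 'u1 \<Rightarrow> 'u2 \<Rightarrow> 'wo \<Rightarrow> 'y"
  stage_cost :: "nat \<Rightarrow> 'x \<Rightarrow> 'u1 \<Rightarrow> 'u2 \<Rightarrow> real"

definition special_game :: "('x, 'u1, 'u2, 'y, 'ws, 'wo) game \<Rightarrow> bool" where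
  "special_game G \<longleftrightarrow>
     (\<forall>t\<in>{1..horizon G}.
        finite (states G t) \<and> finite (observations G t) \<and>
        finite (actions1 G t) \<and> actions1 G t \<noteq> {} \<and>
        finite (actions2 G t) \<and> actions2 G t \<noteq> {} \<and>
        finite (set_pmf (state_noise G t)) \<and> finite (set_pmf (obs_noise G t))) \<and>
     finite (set_pmf (init G)) \<and>
     (1 \<le> horizon G \<longrightarrow>
        set_pmf (init G) \<subseteq> states G 1 \<and>
        (\<forall>x\<in>states G 1. \<forall>w\<in>set_pmf (obs_noise G 1). obs_init G x w \<in> observations G 1)) \<and>
     (\<forall>t. 1 \<le> t \<and> t < horizon G \<longrightarrow>
        (\<forall>x\<in>states G t. \<forall>a\<in>actions1 G t. \<forall>b\<in>actions2 G t. \<forall>w\<in>set_pmf (state_noise G t).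
           trans_map G t x a b w \<in> states G (Suc t)) \<and>
        (\<forall>x\<in>states G (Suc t). \<forall>a\<in>actions1 G t. \<forall>b\<in>actions2 G t. \<forall>w\<in>set_pmf (obs_noise G (Suc t)).
           obs G (Suc t) x a b w \<in> observations G (Suc t)))"

text \<open>Sequences indexed by times \<open>1, \<dots>, n\<close> are lists; time \<open>t\<close> sits at list position
  \<open>t - 1\<close>.\<close>

definition seqs :: "(nat \<Rightarrow> 'a set) \<Rightarrow> nat \<Rightarrow> 'a list set" where
  "seqs A n = {as. length as = n \<and> (\<forall>i<n. as ! i \<in> A (Suc i))}"

type_synonym ('x, 'u1, 'u2, 'y) info1 = "'x list \<times> 'y list \<times> 'u1 list \<times> 'u2 list"
type_synonym ('u2, 'y) info2 = "'y list \<times> 'u2 list"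

type_synonym ('x, 'u1, 'u2, 'y) strat1 = "nat \<Rightarrow> ('x, 'u1, 'u2, 'y) info1 \<Rightarrow> 'u1 pmf"
type_synonym ('u2, 'y) strat2 = "nat \<Rightarrow> ('u2, 'y) info2 \<Rightarrow> 'u2 pmf"

definition infos1 :: "('x, 'u1, 'u2, 'y, 'ws, 'wo) game \<Rightarrow> nat \<Rightarrow> ('x, 'u1, 'u2, 'y) info1 set" where
  "infos1 G t = seqs (states G) t \<times> seqs (observations G) t \<times>
                seqs (actions1 G) (t - 1) \<times> seqs (actions2 G) (t - 1)"

definition infos2 :: "('x, 'u1, 'u2, 'y, 'ws, 'wo) game \<Rightarrow> nat \<Rightarrow> ('u2, 'y) info2 set" where
  "infos2 G t = seqs (observations G) t \<times> seqs (actions2 G) (t - 1)"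

text \<open>A strategy's values outside the realizations of the information are irrelevant: such
  arguments never occur in play.\<close>

definition behavioral1 ::
    "('x, 'u1, 'u2, 'y, 'ws, 'wo) game \<Rightarrow> ('x, 'u1, 'u2, 'y) strat1 \<Rightarrow> bool" where
  "behavioral1 G g \<longleftrightarrow>
     (\<forall>t\<in>{1..horizon G}. \<forall>i\<in>infos1 G t. set_pmf (g t i) \<subseteq> actions1 G t)"

definition behavioral2 ::
    "('x, 'u1, 'u2, 'y, 'ws, 'wo) game \<Rightarrow> ('u2, 'y) strat2 \<Rightarrow> bool" where
  "behavioral2 G g \<longleftrightarrow>
     (\<forall>t\<in>{1..horizon G}. \<forall>i\<in>infos2 G t. set_pmf (g t i) \<subseteq> actions2 G t)"

text \<open>Mutual independence of the basic random variables: their joint law is the product law.\<close>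

definition basic_law ::
    "('x, 'u1, 'u2, 'y, 'ws, 'wo) game \<Rightarrow> ('x \<times> (nat \<Rightarrow> 'ws) \<times> (nat \<Rightarrow> 'wo)) pmf" where
  "basic_law G =
     pair_pmf (init G)
       (pair_pmf (Pi_pmf {1..horizon G} undefined (state_noise G))
                 (Pi_pmf {1..horizon G} undefined (obs_noise G)))"

text \<open>
  Law of \<open>(X\<^sub>1\<^sub>:\<^sub>n, Y\<^sub>1\<^sub>:\<^sub>n, U\<^sup>1\<^sub>1\<^sub>:\<^sub>n, U\<^sup>2\<^sub>1\<^sub>:\<^sub>n)\<close> given the values of the basic random
  variables; the randomness left is that of the two players. The step from \<open>n\<close> to
  \<open>Suc n\<close> produces the variables of time \<open>Suc n\<close>, and \<open>last\<close> refers to time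
  \<open>n\<close>.
\<close>

primrec play ::
    "('x, 'u1, 'u2, 'y, 'ws, 'wo) game \<Rightarrow> ('x, 'u1, 'u2, 'y) strat1 \<Rightarrow> ('u2, 'y) strat2 \<Rightarrow>
     'x \<times> (nat \<Rightarrow> 'ws) \<times> (nat \<Rightarrow> 'wo) \<Rightarrow> nat \<Rightarrow>
     ('x list \<times> 'y list \<times> 'u1 list \<times> 'u2 list) pmf" where
  "play G g1 g2 \<omega> 0 = return_pmf ([], [], [], [])"
| "play G g1 g2 \<omega> (Suc n) =
     bind_pmf (play G g1 g2 \<omega> n) (\<lambda>(xs, ys, as, bs).
       let (x1, ws, wo) = \<omega>;
           x = (if n = 0 then x1 else trans_map G n (last xs) (last as) (last bs) (ws n));
           y = (if n = 0 then obs_init G x (wo 1)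
                else obs G (Suc n) x (last as) (last bs) (wo (Suc n)))
       in bind_pmf (g1 (Suc n) (xs @ [x], ys @ [y], as, bs)) (\<lambda>a.
          bind_pmf (g2 (Suc n) (ys @ [y], bs)) (\<lambda>b.
          return_pmf (xs @ [x], ys @ [y], as @ [a], bs @ [b]))))"

definition outcome_law ::
    "('x, 'u1, 'u2, 'y, 'ws, 'wo) game \<Rightarrow> ('x, 'u1, 'u2, 'y) strat1 \<Rightarrow> ('u2, 'y) strat2 \<Rightarrow>
     ('x list \<times> 'y list \<times> 'u1 list \<times> 'u2 list) pmf" where
  "outcome_law G g1 g2 = bind_pmf (basic_law G) (\<lambda>\<omega>. play G g1 g2 \<omega> (horizon G))"

definition total_cost ::
    "('x, 'u1, 'u2, 'y, 'ws, 'wo) game \<Rightarrow> 'x list \<times> 'y list \<times> 'u1 list \<times> 'u2 list \<Rightarrow> real" where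
  "total_cost G = (\<lambda>(xs, ys, as, bs).
     \<Sum>t = 1..horizon G. stage_cost G t (xs ! (t - 1)) (as ! (t - 1)) (bs ! (t - 1)))"

definition J ::
    "('x, 'u1, 'u2, 'y, 'ws, 'wo) game \<Rightarrow> ('x, 'u1, 'u2, 'y) strat1 \<Rightarrow> ('u2, 'y) strat2 \<Rightarrow> real" where
  "J G g1 g2 = measure_pmf.expectation (outcome_law G g1 g2) (total_cost G)"

definition nash_equilibrium ::
    "('x, 'u1, 'u2, 'y, 'ws, 'wo) game \<Rightarrow> ('x, 'u1, 'u2, 'y) strat1 \<Rightarrow> ('u2, 'y) strat2 \<Rightarrow> bool" where
  "nash_equilibrium G g1 g2 \<longleftrightarrow>
     behavioral1 G g1 \<and> behavioral2 G g2 \<and>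
     (\<forall>g2'. behavioral2 G g2' \<longrightarrow> J G g1 g2' \<le> J G g1 g2) \<and>
     (\<forall>g1'. behavioral1 G g1' \<longrightarrow> J G g1 g2 \<le> J G g1' g2)"

end

theory Submission imports Defs begin

text \<open>
  Both players have perfect recall, so the probability of a complete history factors into a chance
  term, independent of the strategies, and the product of each player's own action probabilities.
  Hence the cost is bilinear in the two players' realization plans (sequence form). The realization
  plans of a player form a convex compact polytope, and each of them comes from a behavioral
  strategy by normalizing at the infosets that are reached, so a saddle point over plans is
  a Nash equilibrium. The saddle point comes from a minimax argument that needs no
  vector space structure: separation in the plane handles two points of \<open>X\<close>, induction
  handles finitely many, and compactness of \<open>Y\<close> handles all of them.
\<close>

section \<open>A minimax theorem\<close>

text \<open>The image of \<open>Y\<close> under \<open>(a, b)\<close> is a compact convex subset of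
  the plane that misses the closed nonnegative quadrant. A line strictly separates the two sets; its
  normal has nonnegative coordinates, and scaling their sum to 1 gives the weight
  \<open>s\<close>.\<close>

lemma two_point_alternative:
  fixes a b :: "'y::topological_space \<Rightarrow> real"
  assumes "compact Y" "continuous_on Y a" "continuous_on Y b"
    and convexlike: "\<And>y y' s. y \<in> Y \<Longrightarrow> y' \<in> Y \<Longrightarrow> 0 \<le> s \<Longrightarrow> s \<le> 1 \<Longrightarrow>
      \<exists>z\<in>Y. a z = s * a y + (1 - s) * a y' \<and> b z = s * b y + (1 - s) * b y'"
    and neg: "\<And>y. y \<in> Y \<Longrightarrow> a y < 0 \<or> b y < 0"
  shows "\<exists>s. 0 \<le> s \<and> s \<le> 1 \<and> (\<forall>y\<in>Y. s * a y + (1 - s) * b y < 0)"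
proof (cases "Y = {}")
  case True
  then show ?thesis by (intro exI[of _ 0]) auto
next
  case False
  define C where "C = (\<lambda>y. (a y, b y)) ` Y"
  define D :: "(real \<times> real) set" where "D = {0..} \<times> {0..}"
  have "compact C"
    unfolding C_def using assms(1-3) by (intro compact_continuous_image continuous_intros)
  moreover have "convex C"
    unfolding convex_alt
  proof (intro ballI allI impI)
    fix p q :: "real \<times> real" and u :: real
    assume "p \<in> C" "q \<in> C" and u: "0 \<le> u \<and> u \<le> 1"
    then obtain y y' where y: "y \<in> Y" "y' \<in> Y" "p = (a y, b y)" "q = (a y', b y')"
      by (auto simp: C_def)
    \<comment> \<open>\<open>convex_alt\<close> puts the weight \<open>u\<close> on the second
      point, hence the swapped order of \<open>y\<close> and \<open>y'\<close>.\<close>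
    from convexlike[OF y(2,1), of u] u
    obtain z where "z \<in> Y" "a z = u * a y' + (1 - u) * a y" "b z = u * b y' + (1 - u) * b y"
      by auto
    then show "(1 - u) *\<^sub>R p + u *\<^sub>R q \<in> C"
      unfolding C_def y(3,4) by (intro image_eqI[of _ _ z]) auto
  qed
  moreover have "convex D" "closed D"
    by (auto simp: D_def intro!: convex_Times closed_Times)
  moreover have "C \<noteq> {}" "C \<inter> D = {}"
    using False neg by (force simp: C_def D_def)+
  ultimately obtain n c where sep: "\<forall>x\<in>C. inner n x < c" "\<forall>x\<in>D. inner n x > c"
    using separating_hyperplane_compact_closed[of C D] by auto
  obtain p q where n: "n = (p, q)" by (cases n)
  have C: "p * a y + q * b y < c" if "y \<in> Y" for y
    using sep(1) that by (auto simp: C_def n)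
  have D: "p * u + q * v > c" if "0 \<le> u" "0 \<le> v" for u v
    using sep(2) that by (auto simp: D_def n)
  have c: "c < 0" using D[of 0 0] by simp
  \<comment> \<open>If \<open>p\<close> were negative, the point \<open>(c / p, 0)\<close> of the
    quadrant would lie on the separating line itself. The same works for \<open>q\<close>.\<close>
  have p: "0 \<le> p"
  proof (rule ccontr)
    assume "\<not> 0 \<le> p"
    then show False using D[of "c / p" 0] c by (auto simp: divide_nonpos_neg)
  qed
  have q: "0 \<le> q"
  proof (rule ccontr)
    assume "\<not> 0 \<le> q"
    then show False using D[of 0 "c / q"] c by (auto simp: divide_nonpos_neg)
  qed
  \<comment> \<open>Otherwise the normal vanishes, and any point of the nonempty set
    \<open>C\<close> gives \<open>0 < c\<close>.\<close>
  have pq: "p + q > 0"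
  proof (rule ccontr)
    assume "\<not> p + q > 0"
    then have "p = 0" "q = 0" using p q by auto
    then show False using C c False by force
  qed
  show ?thesis
  proof (intro exI[of _ "p / (p + q)"] conjI ballI)
    fix y assume "y \<in> Y"
    then have "p * a y + q * b y < 0" using C c by force
    then have "(p * a y + q * b y) / (p + q) < 0" using pq by (simp add: divide_neg_pos)
    moreover have "1 - p / (p + q) = q / (p + q)" using pq by (simp add: field_simps)
    ultimately show "p / (p + q) * a y + (1 - p / (p + q)) * b y < 0"
      by (simp add: add_divide_distrib)
  qed (use p q pq in auto)
qed

text \<open>Induction on \<open>F\<close> with \<open>Y\<close> generalized: a new point
  \<open>x0\<close> is absorbed by shrinking \<open>Y\<close> to the superlevel set
  \<open>Y'\<close> of \<open>f x0\<close>, and the assumptions on \<open>Y\<close> have to survive.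
  If some \<open>x\<close> had no good answer left in \<open>Y'\<close>, then
  \<open>two_point_alternative\<close> for \<open>x\<close> and \<open>x0\<close> would yield a
  mixture of the two with no good answer in all of \<open>Y\<close>.\<close>

lemma finite_common_point:
  fixes f :: "'x \<Rightarrow> 'y::topological_space \<Rightarrow> real"
  assumes "finite F" "F \<subseteq> X"
    and "compact Y"
    and cont: "\<And>x. continuous_on UNIV (f x)"
    and convex1: "\<And>x x' s. x \<in> X \<Longrightarrow> x' \<in> X \<Longrightarrow> 0 \<le> s \<Longrightarrow> s \<le> 1 \<Longrightarrow>
      \<exists>z\<in>X. \<forall>y. f z y = s * f x y + (1 - s) * f x' y"
    and convex2: "\<And>y y' s. y \<in> Y \<Longrightarrow> y' \<in> Y \<Longrightarrow> 0 \<le> s \<Longrightarrow> s \<le> 1 \<Longrightarrow>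
      \<exists>z\<in>Y. \<forall>x. f x z = s * f x y + (1 - s) * f x y'"
    and "X \<noteq> {}" "\<And>x. x \<in> X \<Longrightarrow> \<exists>y\<in>Y. \<alpha> \<le> f x y"
  shows "\<exists>y\<in>Y. \<forall>x\<in>F. \<alpha> \<le> f x y"
  using assms(1-3) convex2 assms(8)
proof (induction F arbitrary: Y rule: finite_induct)
  case empty
  then show ?case using \<open>X \<noteq> {}\<close> by auto
next
  case (insert x0 F)
  define Y' where "Y' = Y \<inter> {y. \<alpha> \<le> f x0 y}"
  have x0: "x0 \<in> X" using insert.prems by auto
  have "compact Y'"
    unfolding Y'_def using insert.prems(2)
    by (intro compact_Int_closed closed_Collect_le cont continuous_on_const)
  moreover have "\<exists>z\<in>Y'. \<forall>x. f x z = s * f x y + (1 - s) * f x y'"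
    if y: "y \<in> Y'" "y' \<in> Y'" "0 \<le> s" "s \<le> 1" for y y' s
  proof -
    obtain z where z: "z \<in> Y" "\<forall>x. f x z = s * f x y + (1 - s) * f x y'"
      using insert.prems(3)[of y y' s] y by (auto simp: Y'_def)
    have "\<alpha> = s * \<alpha> + (1 - s) * \<alpha>" by (simp add: algebra_simps)
    also have "\<dots> \<le> s * f x0 y + (1 - s) * f x0 y'"
      using y by (intro add_mono mult_left_mono) (auto simp: Y'_def)
    finally show ?thesis using z by (intro bexI[of _ z]) (auto simp: Y'_def)
  qed
  moreover have "\<exists>y\<in>Y'. \<alpha> \<le> f x y" if x: "x \<in> X" for x
  proof (rule ccontr)
    assume *: "\<not> ?thesis"
    have "\<exists>s. 0 \<le> s \<and> s \<le> 1 \<and> (\<forall>y\<in>Y. s * (f x y - \<alpha>) + (1 - s) * (f x0 y - \<alpha>) < 0)"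
    proof (rule two_point_alternative)
      show "compact Y" by fact
      show "continuous_on Y (\<lambda>y. f x y - \<alpha>)" "continuous_on Y (\<lambda>y. f x0 y - \<alpha>)"
        by (auto intro!: continuous_intros intro: continuous_on_subset[OF cont])
      \<comment> \<open>Outside \<open>Y'\<close> the second inequality holds by definition, inside
        \<open>Y'\<close> the first by the assumption to be refuted.\<close>
      show "f x y - \<alpha> < 0 \<or> f x0 y - \<alpha> < 0" if "y \<in> Y" for y
        using * that by (force simp: Y'_def)
      fix y y' and s :: real
      assume "y \<in> Y" "y' \<in> Y" "0 \<le> s" "s \<le> 1"
      then obtain z where "z \<in> Y" "\<forall>x. f x z = s * f x y + (1 - s) * f x y'"
        using insert.prems(3) by blast
      then show "\<exists>z\<in>Y. f x z - \<alpha> = s * (f x y - \<alpha>) + (1 - s) * (f x y' - \<alpha>) \<and>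
          f x0 z - \<alpha> = s * (f x0 y - \<alpha>) + (1 - s) * (f x0 y' - \<alpha>)"
        by (intro bexI[of _ z]) (auto simp: algebra_simps)
    qed
    then obtain s where s: "0 \<le> s" "s \<le> 1"
      and neg: "\<And>y. y \<in> Y \<Longrightarrow> s * (f x y - \<alpha>) + (1 - s) * (f x0 y - \<alpha>) < 0" by auto
    obtain z where z: "z \<in> X" "\<And>y. f z y = s * f x y + (1 - s) * f x0 y"
      using convex1[OF x x0 s] by auto
    obtain y where "y \<in> Y" "\<alpha> \<le> f z y" using insert.prems(4)[OF z(1)] by auto
    with neg[of y] show False by (auto simp: z(2) algebra_simps)
  qed
  ultimately obtain y where "y \<in> Y'" "\<forall>x\<in>F. \<alpha> \<le> f x y"
    using insert.IH[of Y'] insert.prems(1) by auto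
  then show ?case by (auto simp: Y'_def)
qed

lemma common_point:
  fixes f :: "'x \<Rightarrow> 'y::topological_space \<Rightarrow> real"
  assumes "X \<noteq> {}" "compact Y"
    and cont: "\<And>x. continuous_on UNIV (f x)"
    and convex1: "\<And>x x' s. x \<in> X \<Longrightarrow> x' \<in> X \<Longrightarrow> 0 \<le> s \<Longrightarrow> s \<le> 1 \<Longrightarrow>
      \<exists>z\<in>X. \<forall>y. f z y = s * f x y + (1 - s) * f x' y"
    and convex2: "\<And>y y' s. y \<in> Y \<Longrightarrow> y' \<in> Y \<Longrightarrow> 0 \<le> s \<Longrightarrow> s \<le> 1 \<Longrightarrow>
      \<exists>z\<in>Y. \<forall>x. f x z = s * f x y + (1 - s) * f x y'"
    and "\<And>x. x \<in> X \<Longrightarrow> \<exists>y\<in>Y. \<alpha> \<le> f x y"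
  shows "\<exists>y\<in>Y. \<forall>x\<in>X. \<alpha> \<le> f x y"
proof -
  have "Y \<inter> (\<Inter>x\<in>X. {y. \<alpha> \<le> f x y}) \<noteq> {}"
  proof (rule compact_imp_fip_image)
    show "compact Y" by fact
    show "closed {y. \<alpha> \<le> f x y}" for x
      by (intro closed_Collect_le cont continuous_on_const)
    fix F assume "finite F" "F \<subseteq> X"
    from finite_common_point[OF this assms(2) cont convex1 convex2 assms(1,6)]
    show "Y \<inter> (\<Inter>x\<in>F. {y. \<alpha> \<le> f x y}) \<noteq> {}" by blast
  qed
  then show ?thesis by auto
qed

text \<open>The value \<open>v\<close> is the infimum over \<open>x\<close> of the best reply value.
  One use of \<open>common_point\<close> gives a \<open>y\<close> securing at least \<open>v\<close>
  against every \<open>x\<close>; a second use, for \<open>-f\<close> with the players exchanged,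
  gives an \<open>x\<close> conceding at most \<open>v\<close>. Such a pair is a saddle
  point.\<close>

lemma minimax_saddle_point:
  fixes f :: "'x::topological_space \<Rightarrow> 'y::topological_space \<Rightarrow> real"
  assumes X: "compact X" "X \<noteq> {}" and Y: "compact Y" "Y \<noteq> {}"
    and cont1: "\<And>y. continuous_on UNIV (\<lambda>x. f x y)"
    and cont2: "\<And>x. continuous_on UNIV (f x)"
    and convex1: "\<And>x x' s. x \<in> X \<Longrightarrow> x' \<in> X \<Longrightarrow> 0 \<le> s \<Longrightarrow> s \<le> 1 \<Longrightarrow>
      \<exists>z\<in>X. \<forall>y. f z y = s * f x y + (1 - s) * f x' y"
    and convex2: "\<And>y y' s. y \<in> Y \<Longrightarrow> y' \<in> Y \<Longrightarrow> 0 \<le> s \<Longrightarrow> s \<le> 1 \<Longrightarrow>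
      \<exists>z\<in>Y. \<forall>x. f x z = s * f x y + (1 - s) * f x y'"
  obtains x y where "x \<in> X" "y \<in> Y" "\<And>y'. y' \<in> Y \<Longrightarrow> f x y' \<le> f x y"
    "\<And>x'. x' \<in> X \<Longrightarrow> f x y \<le> f x' y"
proof -
  define S where "S = {\<alpha>. \<forall>x\<in>X. \<exists>y\<in>Y. \<alpha> \<le> f x y}"
  define v where "v = Sup S"
  have min: "\<exists>x\<in>X. \<forall>x'\<in>X. f x y \<le> f x' y" for y
    using continuous_attains_inf[OF X, of "\<lambda>x. f x y"] continuous_on_subset[OF cont1] by auto
  have max: "\<exists>y\<in>Y. \<forall>y'\<in>Y. f x y' \<le> f x y" for x
    using continuous_attains_sup[OF Y, of "f x"] continuous_on_subset[OF cont2] by auto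
  have "S \<noteq> {}" using min Y(2) unfolding S_def by blast
  obtain x0 y0 where xy0: "x0 \<in> X" "\<forall>y\<in>Y. f x0 y \<le> f x0 y0" using X(2) max by blast
  have bdd: "bdd_above S"
    using xy0 by (intro bdd_aboveI[of _ "f x0 y0"]) (force simp: S_def)
  \<comment> \<open>The level \<open>v\<close> itself is attained, because the best reply value
    against \<open>x\<close> bounds all of \<open>S\<close>.\<close>
  have "\<exists>y\<in>Y. v \<le> f x y" if x: "x \<in> X" for x
  proof -
    obtain y where y: "y \<in> Y" "\<forall>y'\<in>Y. f x y' \<le> f x y" using max by blast
    have "v \<le> f x y"
      unfolding v_def using x y(2) by (intro cSup_least \<open>S \<noteq> {}\<close>) (force simp: S_def)
    with y show ?thesis by auto
  qed
  from common_point[OF X(2) Y(1) cont2 convex1 convex2 this]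
  obtain y where y: "y \<in> Y" "\<forall>x\<in>X. v \<le> f x y" by blast
  \<comment> \<open>The minimum of \<open>f\<close> over \<open>X\<close> for this fixed
    \<open>y\<close> is a level in \<open>S\<close>, with \<open>y\<close> as the answer to every
    \<open>x\<close>; hence it is at most \<open>v\<close>.\<close>
  have "\<exists>x\<in>X. - v \<le> - f x y" if "y \<in> Y" for y
  proof -
    obtain x where "x \<in> X" "\<forall>x'\<in>X. f x y \<le> f x' y" using min by blast
    moreover from this have "f x y \<in> S" using that by (auto simp: S_def)
    then have "f x y \<le> v" unfolding v_def by (rule cSup_upper[OF _ bdd])
    ultimately show ?thesis by auto
  qed
  moreover have "continuous_on UNIV (\<lambda>x. - f x y)" for y
    by (intro continuous_intros cont1)
  moreover have "\<exists>z\<in>Y. \<forall>x. - f x z = s * - f x y + (1 - s) * - f x y'"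
    if "y \<in> Y" "y' \<in> Y" "0 \<le> s" "s \<le> 1" for y y' s
    using convex2[OF that] by (metis (no_types, opaque_lifting) minus_add_distrib mult_minus_right)
  moreover have "\<exists>z\<in>X. \<forall>y. - f z y = s * - f x y + (1 - s) * - f x' y"
    if "x \<in> X" "x' \<in> X" "0 \<le> s" "s \<le> 1" for x x' s
    using convex1[OF that] by (metis (no_types, opaque_lifting) minus_add_distrib mult_minus_right)
  ultimately obtain x where x: "x \<in> X" "\<forall>y\<in>Y. - v \<le> - f x y"
    using common_point[OF Y(2) X(1), of "\<lambda>y x. - f x y" "- v"] by blast
  have "f x y = v" using x y by force
  with x y that show thesis by (metis neg_le_iff_le)
qed

section \<open>Realization plans of a player with perfect recall\<close>

text \<open>The infoset \<open>i\<close> at time \<open>Suc (Suc n)\<close> is entered from the infoset \<open>fst (prev i)\<close> at time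
  \<open>Suc n\<close>, by the player's own action \<open>snd (prev i)\<close>; this is perfect recall. A realization plan is
  indexed by \<open>(n, i, a)\<close> with \<open>i\<close> an infoset at time \<open>Suc n\<close>.\<close>

primrec reach :: "('i \<Rightarrow> 'i \<times> 'a) \<Rightarrow> (nat \<Rightarrow> 'i \<Rightarrow> 'a pmf) \<Rightarrow> nat \<Rightarrow> 'i \<Rightarrow> real" where
  "reach prev g 0 i = 1"
| "reach prev g (Suc n) i =
     reach prev g n (fst (prev i)) * pmf (g (Suc n) (fst (prev i))) (snd (prev i))"

definition plan_of :: "('i \<Rightarrow> 'i \<times> 'a) \<Rightarrow> (nat \<Rightarrow> 'i \<Rightarrow> 'a pmf) \<Rightarrow> nat \<times> 'i \<times> 'a \<Rightarrow> real" where
  "plan_of prev g = (\<lambda>(n, i, a). reach prev g n i * pmf (g (Suc n) i) a)"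

lemma reach_Suc: "reach prev g (Suc n) i = plan_of prev g (n, prev i)"
  by (cases "prev i") (simp add: plan_of_def)

lemma reach_bounds: "0 \<le> reach prev g n i" "reach prev g n i \<le> 1"
  by (induction n arbitrary: i) (auto intro!: mult_le_one simp: pmf_le_1)

locale player =
  fixes T :: nat and I :: "nat \<Rightarrow> 'i set" and A :: "nat \<Rightarrow> 'a set" and prev :: "'i \<Rightarrow> 'i \<times> 'a"
  assumes finite_A: "\<And>n. n < T \<Longrightarrow> finite (A (Suc n))"
    and A_nonempty: "\<And>n. n < T \<Longrightarrow> A (Suc n) \<noteq> {}"
    and prev_in: "\<And>n i. Suc n < T \<Longrightarrow> i \<in> I (Suc (Suc n)) \<Longrightarrow> prev i \<in> I (Suc n) \<times> A (Suc n)"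
begin

definition behavioral :: "(nat \<Rightarrow> 'i \<Rightarrow> 'a pmf) \<Rightarrow> bool" where
  "behavioral g \<longleftrightarrow> (\<forall>n<T. \<forall>i\<in>I (Suc n). set_pmf (g (Suc n) i) \<subseteq> A (Suc n))"

text \<open>For the plan of a strategy this is the \<open>reach\<close> weight of \<open>i\<close>.
  The constant 1 is the weight of the empty sequence of own actions.\<close>

definition inflow :: "(nat \<times> 'i \<times> 'a \<Rightarrow> real) \<Rightarrow> nat \<Rightarrow> 'i \<Rightarrow> real" where
  "inflow r n i = (case n of 0 \<Rightarrow> 1 | Suc m \<Rightarrow> r (m, prev i))"

text \<open>The flow constraints of the sequence form. The bounds apply to every index, also outside
  the infosets, so that \<open>plans\<close> is a closed part of a cube.\<close>

definition plans :: "(nat \<times> 'i \<times> 'a \<Rightarrow> real) set" where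
  "plans = (UNIV \<rightarrow> {0..1}) \<inter>
     {r. \<forall>n<T. \<forall>i\<in>I (Suc n). (\<Sum>a\<in>A (Suc n). r (n, i, a)) = inflow r n i}"

lemma behavioral_exists: "\<exists>g. behavioral g"
proof
  show "behavioral (\<lambda>t i. return_pmf (SOME a. a \<in> A t))"
    using A_nonempty by (auto simp: behavioral_def some_in_eq)
qed

lemma plan_of_in_plans:
  assumes "behavioral g"
  shows "plan_of prev g \<in> plans"
proof -
  have "plan_of prev g s \<in> {0..1}" for s
    by (cases s) (auto simp: plan_of_def reach_bounds pmf_le_1 intro!: mult_le_one mult_nonneg_nonneg)
  moreover have "(\<Sum>a\<in>A (Suc n). plan_of prev g (n, i, a)) = inflow (plan_of prev g) n i"
    if "n < T" "i \<in> I (Suc n)" for n i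
  proof -
    have "(\<Sum>a\<in>A (Suc n). plan_of prev g (n, i, a))
        = reach prev g n i * (\<Sum>a\<in>A (Suc n). pmf (g (Suc n) i) a)"
      by (simp add: plan_of_def sum_distrib_left)
    also have "(\<Sum>a\<in>A (Suc n). pmf (g (Suc n) i) a) = 1"
      using assms that finite_A by (intro sum_pmf_eq_1) (auto simp: behavioral_def)
    also have "reach prev g n i * 1 = inflow (plan_of prev g) n i"
      by (cases n) (simp_all add: inflow_def reach_Suc del: reach.simps(2))
    finally show ?thesis .
  qed
  ultimately show ?thesis by (auto simp: plans_def)
qed

lemma plans_nonempty: "plans \<noteq> {}"
  using behavioral_exists plan_of_in_plans by blast

lemma continuous_on_inflow: "continuous_on UNIV (\<lambda>r. inflow r n i)"
  by (cases n) (auto simp: inflow_def intro!: continuous_intros)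

text \<open>The cube is compact by Tychonoff's theorem, and each flow constraint equates two
  continuous functions of the plan.\<close>

lemma compact_plans: "compact plans"
proof -
  have "compact (PiE UNIV (\<lambda>_. {0..1}) :: (nat \<times> 'i \<times> 'a \<Rightarrow> real) set)"
    unfolding compactin_euclidean_iff[symmetric] euclidean_product_topology[symmetric] compactin_PiE
    by (simp add: compactin_euclidean_iff)
  moreover have "closed {r. \<forall>n<T. \<forall>i\<in>I (Suc n). (\<Sum>a\<in>A (Suc n). r (n, i, a)) = inflow r n i}"
    unfolding Ball_def
    by (intro closed_Collect_all closed_Collect_imp open_Collect_const closed_Collect_eq
        continuous_on_inflow continuous_intros) auto
  ultimately show ?thesis
    unfolding plans_def by (intro compact_Int_closed) (simp_all add: PiE_UNIV_domain)
qed

lemma plans_convex: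
  assumes "r \<in> plans" "r' \<in> plans" "0 \<le> s" "s \<le> 1"
  shows "(\<lambda>x. s * r x + (1 - s) * r' x) \<in> plans"
proof -
  have "s * r x + (1 - s) * r' x \<in> {0..1}" for x
  proof -
    have "r x \<in> {0..1}" "r' x \<in> {0..1}" using assms by (auto simp: plans_def)
    then show ?thesis using assms(3,4) convex_bound_le[of "r x" 1 "r' x" s "1 - s"] by auto
  qed
  then show ?thesis
    using assms
    by (auto simp: plans_def inflow_def sum.distrib sum_distrib_left[symmetric] split: nat.split)
qed

text \<open>At an infoset with positive inflow, dividing the plan by the inflow gives a distribution
  on actions. With inflow 0 all outgoing weights vanish, so any action will do. Multiplying back
  along the predecessors recovers the plan.\<close>

lemma plan_induced_by_behavioral:
  assumes "r \<in> plans"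
  obtains g where "behavioral g"
    "\<And>n i a. n < T \<Longrightarrow> i \<in> I (Suc n) \<Longrightarrow> a \<in> A (Suc n) \<Longrightarrow> plan_of prev g (n, i, a) = r (n, i, a)"
proof -
  have nonneg: "0 \<le> r x" for x using assms by (auto simp: plans_def)
  have flow: "(\<Sum>a\<in>A (Suc n). r (n, i, a)) = inflow r n i" if "n < T" "i \<in> I (Suc n)" for n i
    using assms that by (auto simp: plans_def)
  have "\<exists>p. set_pmf p \<subseteq> A (Suc n) \<and> (\<forall>a\<in>A (Suc n). r (n, i, a) = inflow r n i * pmf p a)"
    if n: "n < T" and i: "i \<in> I (Suc n)" for n i
  proof (cases "inflow r n i = 0")
    case True
    then have "\<forall>a\<in>A (Suc n). r (n, i, a) = 0"
      using flow[OF n i] sum_nonneg_eq_0_iff[OF finite_A[OF n], of "\<lambda>a. r (n, i, a)"] nonneg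
      by simp
    moreover obtain a where "a \<in> A (Suc n)" using A_nonempty[OF n] by auto
    ultimately show ?thesis using True by (intro exI[of _ "return_pmf a"]) auto
  next
    case False
    define w where "w a = (if a \<in> A (Suc n) then r (n, i, a) / inflow r n i else 0)" for a
    have pos: "inflow r n i > 0"
      using False flow[OF n i] nonneg by (metis less_eq_real_def sum_nonneg)
    have w: "w a \<ge> 0" for a using pos nonneg by (simp add: w_def)
    have "(\<integral>\<^sup>+ a. ennreal (w a) \<partial>count_space UNIV) = (\<Sum>a\<in>A (Suc n). ennreal (w a))"
      using finite_A[OF n] by (intro nn_integral_count_space') (auto simp: w_def)
    also have "\<dots> = ennreal (\<Sum>a\<in>A (Suc n). w a)" using w by (simp add: sum_ennreal)
    also have "(\<Sum>a\<in>A (Suc n). w a) = 1"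
      using False by (simp add: w_def flow[OF n i] sum_divide_distrib[symmetric])
    finally have "pmf (embed_pmf w) a = w a" for a using w by (simp add: pmf_embed_pmf)
    then show ?thesis using False
      by (intro exI[of _ "embed_pmf w"]) (auto simp: w_def set_pmf_eq split: if_splits)
  qed
  then obtain p where p: "\<And>n i. n < T \<Longrightarrow> i \<in> I (Suc n) \<Longrightarrow> set_pmf (p n i) \<subseteq> A (Suc n)"
      "\<And>n i a. n < T \<Longrightarrow> i \<in> I (Suc n) \<Longrightarrow> a \<in> A (Suc n) \<Longrightarrow>
        r (n, i, a) = inflow r n i * pmf (p n i) a"
    by metis
  \<comment> \<open>Strategies are indexed by the time \<open>Suc n\<close>, plans by
    \<open>n\<close>.\<close>
  define g where "g t = p (t - 1)" for t
  have "plan_of prev g (n, i, a) = r (n, i, a)"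
    if "n < T" "i \<in> I (Suc n)" "a \<in> A (Suc n)" for n i a
    using that
  proof (induction n arbitrary: i a)
    case 0
    then show ?case using p(2)[of 0 i a] by (simp add: plan_of_def g_def inflow_def)
  next
    case (Suc n)
    \<comment> \<open>By \<open>prev_in\<close> the predecessor is a genuine infoset with a legal
      action, so the induction hypothesis covers it.\<close>
    then have "plan_of prev g (n, prev i) = r (n, prev i)"
      using prev_in[of n i] by (cases "prev i") auto
    then have "reach prev g (Suc n) i = inflow r (Suc n) i"
      by (simp add: reach_Suc inflow_def del: reach.simps(2))
    then show ?case
      using p(2)[OF Suc.prems] by (simp add: plan_of_def g_def[of "Suc (Suc n)"] del: reach.simps(2))
  qed
  moreover have "behavioral g" using p(1) by (simp add: behavioral_def g_def)
  ultimately show thesis using that by blast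
qed

end

section \<open>The cost as a bilinear function of the realization plans\<close>

lemma seqs_snoc: "xs @ [x] \<in> seqs B (Suc n) \<longleftrightarrow> xs \<in> seqs B n \<and> x \<in> B (Suc n)"
  by (auto simp: seqs_def nth_append less_Suc_eq)

lemma seqs_Suc_cases:
  assumes "zs \<in> seqs B (Suc n)"
  obtains xs x where "zs = xs @ [x]" "xs \<in> seqs B n" "x \<in> B (Suc n)"
proof (cases zs rule: rev_cases)
  case Nil
  then show ?thesis using assms by (simp add: seqs_def)
next
  case (snoc xs x)
  then show ?thesis using assms by (intro that[of xs x]) (auto simp: seqs_snoc)
qed

lemma butlast_last_seqs:
  assumes "xs \<in> seqs B (Suc n)"
  shows "butlast xs \<in> seqs B n" "last xs \<in> B (Suc n)"
  using assms by (auto elim!: seqs_Suc_cases)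

lemma finite_seqs:
  assumes "\<And>i. i < n \<Longrightarrow> finite (B (Suc i))"
  shows "finite (seqs B n)"
proof (rule finite_subset)
  show "seqs B n \<subseteq> {xs. set xs \<subseteq> (\<Union>i<n. B (Suc i)) \<and> length xs = n}"
    by (fastforce simp: seqs_def in_set_conv_nth)
  show "finite {xs. set xs \<subseteq> (\<Union>i<n. B (Suc i)) \<and> length xs = n}"
    using assms by (intro finite_lists_length_eq) auto
qed

section \<open>Factorization of history probabilities\<close>

definition prev1 :: "('x, 'u1, 'u2, 'y) info1 \<Rightarrow> ('x, 'u1, 'u2, 'y) info1 \<times> 'u1" where
  "prev1 = (\<lambda>(xs, ys, as, bs). ((butlast xs, butlast ys, butlast as, butlast bs), last as))"

definition prev2 :: "('u2, 'y) info2 \<Rightarrow> ('u2, 'y) info2 \<times> 'u2" where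
  "prev2 = (\<lambda>(ys, bs). ((butlast ys, butlast bs), last bs))"

text \<open>The chance factor of a history's probability: once \<open>\<omega>\<close> is fixed it
  is 0 or 1, and no strategy enters. The recursion strips last entries, matching the way
  \<open>play\<close> appends them.\<close>

primrec consistent ::
    "('x, 'u1, 'u2, 'y, 'ws, 'wo) game \<Rightarrow> 'x \<times> (nat \<Rightarrow> 'ws) \<times> (nat \<Rightarrow> 'wo) \<Rightarrow> nat \<Rightarrow>
     'x list \<times> 'y list \<times> 'u1 list \<times> 'u2 list \<Rightarrow> bool" where
  "consistent G \<omega> 0 h = True"
| "consistent G \<omega> (Suc n) h = (case h of (xs, ys, as, bs) \<Rightarrow>
     consistent G \<omega> n (butlast xs, butlast ys, butlast as, butlast bs) \<and>
     last xs = (if n = 0 then fst \<omega>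
       else trans_map G n (last (butlast xs)) (last (butlast as)) (last (butlast bs))
         (fst (snd \<omega>) n)) \<and>
     last ys = (if n = 0 then obs_init G (last xs) (snd (snd \<omega>) 1)
       else obs G (Suc n) (last xs) (last (butlast as)) (last (butlast bs))
         (snd (snd \<omega>) (Suc n))))"

text \<open>In \<open>play\<close> each draw is recorded in the history, so a given outcome can come
  from only one intermediate value.\<close>

lemma pmf_bind_single:
  assumes "\<And>x. x \<noteq> x0 \<Longrightarrow> z \<notin> set_pmf (k x)"
  shows "pmf (bind_pmf p k) z = pmf p x0 * pmf (k x0) z"
proof -
  have "pmf (bind_pmf p k) z = measure_pmf.expectation p (\<lambda>x. pmf (k x) z)"
    by (rule pmf_bind)
  also have "\<dots> = (\<Sum>x\<in>{x0}. pmf (k x) z * pmf p x)"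
    using assms by (intro integral_measure_pmf_real) (auto simp: set_pmf_iff)
  finally show ?thesis by simp
qed

text \<open>The entries \<open>x\<close>, \<open>y\<close> are dummies that turn a history of length \<open>n\<close> into
  an infoset of time \<open>Suc n\<close>, whose own-action weight involves the first \<open>n\<close> actions only.\<close>

lemma pmf_play:
  assumes "length xs = n" "length ys = n" "length as = n" "length bs = n"
  shows "pmf (play G g1 g2 \<omega> n) (xs, ys, as, bs) =
    of_bool (consistent G \<omega> n (xs, ys, as, bs)) *
    (reach prev1 g1 n (xs @ [x], ys @ [y], as, bs) * reach prev2 g2 n (ys @ [y], bs))"
  using assms
proof (induction n arbitrary: xs ys as bs x y)
  case 0
  then show ?case by simp
next
  case (Suc n)
  obtain x1 ws wo where \<omega>: "\<omega> = (x1, ws, wo)" by (cases \<omega>)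
  obtain xs' x' where xs: "xs = xs' @ [x']" using Suc.prems by (cases xs rule: rev_cases) auto
  obtain ys' y' where ys: "ys = ys' @ [y']" using Suc.prems by (cases ys rule: rev_cases) auto
  obtain as' a where as: "as = as' @ [a]" using Suc.prems by (cases as rule: rev_cases) auto
  obtain bs' b where bs: "bs = bs' @ [b]" using Suc.prems by (cases bs rule: rev_cases) auto
  \<comment> \<open>\<open>X\<close> and \<open>Y\<close> are the state and observation that
    \<open>\<omega>\<close> dictates after the shorter history; \<open>x'\<close> and
    \<open>y'\<close> are those recorded in the target history.\<close>
  define X where "X = (if n = 0 then x1 else trans_map G n (last xs') (last as') (last bs') (ws n))"
  define Y where "Y = (if n = 0 then obs_init G X (wo 1)
    else obs G (Suc n) X (last as') (last bs') (wo (Suc n)))"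
  have "pmf (play G g1 g2 \<omega> (Suc n)) (xs, ys, as, bs) =
      pmf (play G g1 g2 \<omega> n) (xs', ys', as', bs') *
      pmf (bind_pmf (g1 (Suc n) (xs' @ [X], ys' @ [Y], as', bs')) (\<lambda>a.
          bind_pmf (g2 (Suc n) (ys' @ [Y], bs')) (\<lambda>b.
          return_pmf (xs' @ [X], ys' @ [Y], as' @ [a], bs' @ [b])))) (xs, ys, as, bs)"
    unfolding play.simps
    by (subst pmf_bind_single[of "(xs', ys', as', bs')"])
      (auto simp: \<omega> xs ys as bs X_def Y_def Let_def)
  also have "pmf (bind_pmf (g1 (Suc n) (xs' @ [X], ys' @ [Y], as', bs')) (\<lambda>a.
          bind_pmf (g2 (Suc n) (ys' @ [Y], bs')) (\<lambda>b.
          return_pmf (xs' @ [X], ys' @ [Y], as' @ [a], bs' @ [b])))) (xs, ys, as, bs) =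
      pmf (g1 (Suc n) (xs' @ [X], ys' @ [Y], as', bs')) a *
      (pmf (g2 (Suc n) (ys' @ [Y], bs')) b * of_bool (x' = X \<and> y' = Y))"
    by (subst pmf_bind_single[of a], force simp: as, subst pmf_bind_single[of b])
      (auto simp: xs ys as bs)
  \<comment> \<open>The dummies of the induction hypothesis are chosen as \<open>x'\<close> and
    \<open>y'\<close>, which makes its infosets the predecessors needed here.\<close>
  also have "pmf (play G g1 g2 \<omega> n) (xs', ys', as', bs') =
      of_bool (consistent G \<omega> n (xs', ys', as', bs')) *
      (reach prev1 g1 n (xs' @ [x'], ys' @ [y'], as', bs') * reach prev2 g2 n (ys' @ [y'], bs'))"
    using Suc.prems by (intro Suc.IH) (auto simp: xs ys as bs)
  finally have play_Suc: "pmf (play G g1 g2 \<omega> (Suc n)) (xs, ys, as, bs) =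
      of_bool (consistent G \<omega> n (xs', ys', as', bs')) *
      (reach prev1 g1 n (xs' @ [x'], ys' @ [y'], as', bs') * reach prev2 g2 n (ys' @ [y'], bs')) *
      (pmf (g1 (Suc n) (xs' @ [X], ys' @ [Y], as', bs')) a *
       (pmf (g2 (Suc n) (ys' @ [Y], bs')) b * of_bool (x' = X \<and> y' = Y)))" .
  have consistent_Suc: "consistent G \<omega> (Suc n) (xs, ys, as, bs) \<longleftrightarrow>
      consistent G \<omega> n (xs', ys', as', bs') \<and> x' = X \<and> y' = Y"
    by (simp add: xs ys as bs \<omega> X_def Y_def cong: conj_cong)
  have prev: "prev1 (xs @ [x], ys @ [y], as, bs) = ((xs' @ [x'], ys' @ [y'], as', bs'), a)"
    "prev2 (ys @ [y], bs) = ((ys' @ [y'], bs'), b)"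
    by (simp_all only: prev1_def prev2_def as bs prod.case butlast_snoc last_snoc) (simp_all only: xs ys)
  have "reach prev1 g1 (Suc n) (xs @ [x], ys @ [y], as, bs) =
      reach prev1 g1 n (xs' @ [x'], ys' @ [y'], as', bs') *
      pmf (g1 (Suc n) (xs' @ [x'], ys' @ [y'], as', bs')) a"
    "reach prev2 g2 (Suc n) (ys @ [y], bs) =
      reach prev2 g2 n (ys' @ [y'], bs') * pmf (g2 (Suc n) (ys' @ [y'], bs')) b"
    by (simp_all only: reach.simps prev fst_conv snd_conv)
  \<comment> \<open>If the recorded entries agree with \<open>X\<close> and \<open>Y\<close>, both
    sides evaluate the strategies at the same infosets; otherwise both sides are 0.\<close>
  with play_Suc consistent_Suc show ?case
    by (cases "x' = X \<and> y' = Y") (simp_all del: play.simps reach.simps consistent.simps)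
qed

section \<open>Histories that can occur\<close>

definition histories :: "('x, 'u1, 'u2, 'y, 'ws, 'wo) game \<Rightarrow> nat \<Rightarrow>
    ('x list \<times> 'y list \<times> 'u1 list \<times> 'u2 list) set" where
  "histories G n = seqs (states G) n \<times> seqs (observations G) n \<times>
     seqs (actions1 G) n \<times> seqs (actions2 G) n"

lemma finite_histories:
  assumes "special_game G"
  shows "finite (histories G (horizon G))"
  using assms unfolding histories_def special_game_def
  by (intro finite_cartesian_product finite_seqs) auto

lemma basic_law_support:
  assumes "(x1, ws, wo) \<in> set_pmf (basic_law G)"
  shows "x1 \<in> set_pmf (init G)"
    and "t \<in> {1..horizon G} \<Longrightarrow> ws t \<in> set_pmf (state_noise G t)"
    and "t \<in> {1..horizon G} \<Longrightarrow> wo t \<in> set_pmf (obs_noise G t)"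
  using assms by (auto simp: basic_law_def set_Pi_pmf PiE_dflt_def)

text \<open>This makes the expected cost a finite sum over \<open>histories\<close>. Strategies are
  constrained only on genuine infosets, so the induction must also show that play stays inside
  them.\<close>

lemma play_support:
  assumes G: "special_game G" and g: "behavioral1 G g1" "behavioral2 G g2"
    and \<omega>: "\<omega> \<in> set_pmf (basic_law G)" and "n \<le> horizon G"
  shows "set_pmf (play G g1 g2 \<omega> n) \<subseteq> histories G n"
  using assms(5)
proof (induction n)
  case 0
  then show ?case by (simp add: histories_def seqs_def)
next
  case (Suc n)
  obtain x1 ws wo where \<omega>_eq: "\<omega> = (x1, ws, wo)" by (cases \<omega>)
  note supp = basic_law_support[OF \<omega>[unfolded \<omega>_eq]]
  have "set_pmf (let (x1, ws, wo) = \<omega>;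
           x = (if n = 0 then x1 else trans_map G n (last xs) (last as) (last bs) (ws n));
           y = (if n = 0 then obs_init G x (wo 1)
                else obs G (Suc n) x (last as) (last bs) (wo (Suc n)))
       in bind_pmf (g1 (Suc n) (xs @ [x], ys @ [y], as, bs)) (\<lambda>a.
          bind_pmf (g2 (Suc n) (ys @ [y], bs)) (\<lambda>b.
          return_pmf (xs @ [x], ys @ [y], as @ [a], bs @ [b])))) \<subseteq> histories G (Suc n)"
    if "(xs, ys, as, bs) \<in> set_pmf (play G g1 g2 \<omega> n)" for xs ys as bs
  proof -
    have h: "xs \<in> seqs (states G) n" "ys \<in> seqs (observations G) n"
      "as \<in> seqs (actions1 G) n" "bs \<in> seqs (actions2 G) n"
      using Suc that by (auto simp: histories_def)
    define x where "x = (if n = 0 then x1 else trans_map G n (last xs) (last as) (last bs) (ws n))"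
    define y where "y = (if n = 0 then obs_init G x (wo 1)
      else obs G (Suc n) x (last as) (last bs) (wo (Suc n)))"
    have xy: "x \<in> states G (Suc n) \<and> y \<in> observations G (Suc n)"
    proof (cases n)
      case 0
      then show ?thesis
        using G Suc.prems supp(1) supp(3)[of 1] by (auto simp: special_game_def x_def y_def)
    next
      case (Suc m)
      have "last xs \<in> states G n" "last as \<in> actions1 G n" "last bs \<in> actions2 G n"
        using h butlast_last_seqs(2) unfolding Suc by blast+
      moreover have "ws n \<in> set_pmf (state_noise G n)" "wo (Suc n) \<in> set_pmf (obs_noise G (Suc n))"
        using \<open>Suc n \<le> horizon G\<close> Suc by (auto intro!: supp)
      moreover have "1 \<le> n \<and> n < horizon G" using \<open>Suc n \<le> horizon G\<close> Suc by auto
      ultimately show ?thesis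
        using G Suc unfolding special_game_def x_def y_def by simp
    qed
    have t: "Suc n \<in> {1..horizon G}" using Suc.prems by auto
    have i: "(xs @ [x], ys @ [y], as, bs) \<in> infos1 G (Suc n)" "(ys @ [y], bs) \<in> infos2 G (Suc n)"
      using h xy by (auto simp: infos1_def infos2_def seqs_snoc)
    have "set_pmf (g1 (Suc n) (xs @ [x], ys @ [y], as, bs)) \<subseteq> actions1 G (Suc n)"
      "set_pmf (g2 (Suc n) (ys @ [y], bs)) \<subseteq> actions2 G (Suc n)"
      using g t i unfolding behavioral1_def behavioral2_def by blast+
    then show ?thesis
      using h xy unfolding \<omega>_eq by (auto simp: Let_def x_def y_def histories_def seqs_snoc)
  qed
  then show ?case
    unfolding play.simps set_bind_pmf by (intro UN_least) (auto simp only: split_paired_all prod.case)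
qed

text \<open>Only final entries of the plans occur: the entry at the last infoset already carries the
  product of all own action probabilities. The index \<open>horizon G - 1\<close> stands for the
  last time, and \<open>butlast\<close> removes the actions taken at that time.\<close>

definition bilinear_cost ::
    "('x, 'u1, 'u2, 'y, 'ws, 'wo) game \<Rightarrow> (nat \<times> ('x, 'u1, 'u2, 'y) info1 \<times> 'u1 \<Rightarrow> real) \<Rightarrow>
     (nat \<times> ('u2, 'y) info2 \<times> 'u2 \<Rightarrow> real) \<Rightarrow> real" where
  "bilinear_cost G r1 r2 = (\<Sum>(xs, ys, as, bs)\<in>histories G (horizon G).
     total_cost G (xs, ys, as, bs) *
     measure_pmf.expectation (basic_law G)
       (\<lambda>\<omega>. of_bool (consistent G \<omega> (horizon G) (xs, ys, as, bs))) *
     (r1 (horizon G - 1, (xs, ys, butlast as, butlast bs), last as) *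
      r2 (horizon G - 1, (ys, butlast bs), last bs)))"

lemma J_eq_bilinear_cost:
  assumes G: "special_game G" and g: "behavioral1 G g1" "behavioral2 G g2"
    and "horizon G > 0"
  shows "J G g1 g2 = bilinear_cost G (plan_of prev1 g1) (plan_of prev2 g2)"
proof -
  obtain n where n: "horizon G = Suc n" using assms(4) by (cases "horizon G") auto
  have "set_pmf (outcome_law G g1 g2) \<subseteq> histories G (horizon G)"
    using play_support[OF G g _ order_refl] by (auto simp: outcome_law_def simp del: play.simps)
  then have "J G g1 g2 =
      (\<Sum>h\<in>histories G (horizon G). total_cost G h * pmf (outcome_law G g1 g2) h)"
    unfolding J_def using finite_histories[OF G] by (intro integral_measure_pmf_real) auto
  also have "\<dots> = bilinear_cost G (plan_of prev1 g1) (plan_of prev2 g2)"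
    unfolding bilinear_cost_def
  proof (intro sum.cong refl, clarify)
    fix xs ys as bs
    assume "(xs, ys, as, bs) \<in> histories G (horizon G)"
    then have len: "length xs = Suc n" "length ys = Suc n" "length as = Suc n" "length bs = Suc n"
      by (auto simp: histories_def seqs_def n)
    have "pmf (outcome_law G g1 g2) (xs, ys, as, bs) = measure_pmf.expectation (basic_law G)
        (\<lambda>\<omega>. pmf (play G g1 g2 \<omega> (Suc n)) (xs, ys, as, bs))"
      by (simp add: outcome_law_def pmf_bind n)
    also have "\<dots> = measure_pmf.expectation (basic_law G)
        (\<lambda>\<omega>. of_bool (consistent G \<omega> (Suc n) (xs, ys, as, bs)) *
          (reach prev1 g1 (Suc n) (xs @ [undefined], ys @ [undefined], as, bs) *
           reach prev2 g2 (Suc n) (ys @ [undefined], bs)))"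
      using pmf_play[OF len] by metis
    \<comment> \<open>\<open>reach_Suc\<close> turns the weight of the padded infoset into a plan
      entry; \<open>prev1\<close> and \<open>prev2\<close> delete the dummies again.\<close>
    also have "\<dots> = measure_pmf.expectation (basic_law G)
        (\<lambda>\<omega>. of_bool (consistent G \<omega> (Suc n) (xs, ys, as, bs))) *
          (plan_of prev1 g1 (n, (xs, ys, butlast as, butlast bs), last as) *
           plan_of prev2 g2 (n, (ys, butlast bs), last bs))"
      by (simp add: reach_Suc prev1_def prev2_def del: reach.simps consistent.simps)
    finally show "total_cost G (xs, ys, as, bs) * pmf (outcome_law G g1 g2) (xs, ys, as, bs) =
        total_cost G (xs, ys, as, bs) *
        measure_pmf.expectation (basic_law G)
          (\<lambda>\<omega>. of_bool (consistent G \<omega> (horizon G) (xs, ys, as, bs))) *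
        (plan_of prev1 g1 (horizon G - 1, (xs, ys, butlast as, butlast bs), last as) *
         plan_of prev2 g2 (horizon G - 1, (ys, butlast bs), last bs))"
      by (simp add: n del: consistent.simps)
  qed
  finally show ?thesis .
qed

lemma bilinear_cost_linear1:
  "bilinear_cost G (\<lambda>x. s * r x + (1 - s) * r' x) q =
    s * bilinear_cost G r q + (1 - s) * bilinear_cost G r' q"
  unfolding bilinear_cost_def sum_distrib_left sum.distrib[symmetric]
  by (intro sum.cong refl) (auto simp: algebra_simps)

lemma bilinear_cost_linear2:
  "bilinear_cost G q (\<lambda>x. s * r x + (1 - s) * r' x) =
    s * bilinear_cost G q r + (1 - s) * bilinear_cost G q r'"
  unfolding bilinear_cost_def sum_distrib_left sum.distrib[symmetric]
  by (intro sum.cong refl) (auto simp: algebra_simps)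

text \<open>A strategy reproduces a given plan only at genuine infosets and legal actions; these are
  the only entries the cost reads.\<close>

lemma bilinear_cost_cong:
  assumes "horizon G = Suc n"
    and "\<And>i a. i \<in> infos1 G (Suc n) \<Longrightarrow> a \<in> actions1 G (Suc n) \<Longrightarrow> r1 (n, i, a) = r1' (n, i, a)"
    and "\<And>i a. i \<in> infos2 G (Suc n) \<Longrightarrow> a \<in> actions2 G (Suc n) \<Longrightarrow> r2 (n, i, a) = r2' (n, i, a)"
  shows "bilinear_cost G r1 r2 = bilinear_cost G r1' r2'"
  unfolding bilinear_cost_def
proof (intro sum.cong refl, clarify)
  fix xs ys as bs
  assume "(xs, ys, as, bs) \<in> histories G (horizon G)"
  then have "(xs, ys, butlast as, butlast bs) \<in> infos1 G (Suc n)" "last as \<in> actions1 G (Suc n)"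
    "(ys, butlast bs) \<in> infos2 G (Suc n)" "last bs \<in> actions2 G (Suc n)"
    by (auto simp: histories_def infos1_def infos2_def assms(1) intro: butlast_last_seqs)
  then show "total_cost G (xs, ys, as, bs) *
      measure_pmf.expectation (basic_law G)
        (\<lambda>\<omega>. of_bool (consistent G \<omega> (horizon G) (xs, ys, as, bs))) *
      (r1 (horizon G - 1, (xs, ys, butlast as, butlast bs), last as) *
       r2 (horizon G - 1, (ys, butlast bs), last bs)) =
      total_cost G (xs, ys, as, bs) *
      measure_pmf.expectation (basic_law G)
        (\<lambda>\<omega>. of_bool (consistent G \<omega> (horizon G) (xs, ys, as, bs))) *
      (r1' (horizon G - 1, (xs, ys, butlast as, butlast bs), last as) *
       r2' (horizon G - 1, (ys, butlast bs), last bs))"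
    using assms by simp
qed

section \<open>Existence of an equilibrium\<close>

theorem lemma5:
  fixes G :: "('x, 'u1, 'u2, 'y, 'ws, 'wo) game"
  assumes "special_game G"
  shows "\<exists>g1 g2. nash_equilibrium G g1 g2"
proof (cases "horizon G")
  case 0
  \<comment> \<open>With horizon 0 nothing is played, so the cost is constant and every profile is
    an equilibrium.\<close>
  have "J G g1 g2 = J G g1' g2'" for g1 g2 g1' g2'
    by (simp add: J_def outcome_law_def 0)
  then have "nash_equilibrium G (\<lambda>_ _. return_pmf undefined) (\<lambda>_ _. return_pmf undefined)"
    by (auto simp: nash_equilibrium_def behavioral1_def behavioral2_def 0) (metis order_refl)+
  then show ?thesis by blast
next
  case (Suc n)
  interpret p1: player "horizon G" "infos1 G" "actions1 G" prev1
  proof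
    fix n :: nat and i :: "('x, 'u1, 'u2, 'y) info1"
    assume "i \<in> infos1 G (Suc (Suc n))"
    then show "prev1 i \<in> infos1 G (Suc n) \<times> actions1 G (Suc n)"
      by (auto simp: infos1_def prev1_def dest: butlast_last_seqs)
  qed (use assms in \<open>auto simp: special_game_def\<close>)
  interpret p2: player "horizon G" "infos2 G" "actions2 G" prev2
  proof
    fix n :: nat and i :: "('u2, 'y) info2"
    assume "i \<in> infos2 G (Suc (Suc n))"
    then show "prev2 i \<in> infos2 G (Suc n) \<times> actions2 G (Suc n)"
      by (auto simp: infos2_def prev2_def dest: butlast_last_seqs)
  qed (use assms in \<open>auto simp: special_game_def\<close>)
  have b1: "behavioral1 G g \<longleftrightarrow> p1.behavioral g" for g
    unfolding behavioral1_def p1.behavioral_def image_Suc_lessThan[symmetric] by auto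
  have b2: "behavioral2 G g \<longleftrightarrow> p2.behavioral g" for g
    unfolding behavioral2_def p2.behavioral_def image_Suc_lessThan[symmetric] by auto
  obtain r1 r2 where r: "r1 \<in> p1.plans" "r2 \<in> p2.plans"
    and max: "\<And>q. q \<in> p2.plans \<Longrightarrow> bilinear_cost G r1 q \<le> bilinear_cost G r1 r2"
    and min: "\<And>q. q \<in> p1.plans \<Longrightarrow> bilinear_cost G r1 r2 \<le> bilinear_cost G q r2"
  proof (rule minimax_saddle_point[of p1.plans p2.plans "bilinear_cost G"])
    show "continuous_on UNIV (\<lambda>r. bilinear_cost G r q)" for q
      unfolding bilinear_cost_def case_prod_beta by (intro continuous_intros) auto
    show "continuous_on UNIV (bilinear_cost G q)" for q
      unfolding bilinear_cost_def case_prod_beta by (intro continuous_intros) auto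
    show "\<exists>z\<in>p1.plans. \<forall>q. bilinear_cost G z q =
        s * bilinear_cost G r q + (1 - s) * bilinear_cost G r' q"
      if "r \<in> p1.plans" "r' \<in> p1.plans" "0 \<le> s" "s \<le> 1" for r r' s
      using p1.plans_convex[OF that] bilinear_cost_linear1 by blast
    show "\<exists>z\<in>p2.plans. \<forall>q. bilinear_cost G q z =
        s * bilinear_cost G q r + (1 - s) * bilinear_cost G q r'"
      if "r \<in> p2.plans" "r' \<in> p2.plans" "0 \<le> s" "s \<le> 1" for r r' s
      using p2.plans_convex[OF that] bilinear_cost_linear2 by blast
    show "compact p1.plans" "p1.plans \<noteq> {}" "compact p2.plans" "p2.plans \<noteq> {}"
      by (fact p1.compact_plans p1.plans_nonempty p2.compact_plans p2.plans_nonempty)+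
  qed (rule that)
  obtain g1 where g1: "p1.behavioral g1"
    "\<And>n i a. n < horizon G \<Longrightarrow> i \<in> infos1 G (Suc n) \<Longrightarrow> a \<in> actions1 G (Suc n) \<Longrightarrow>
      plan_of prev1 g1 (n, i, a) = r1 (n, i, a)"
    using p1.plan_induced_by_behavioral[OF r(1)] by blast
  obtain g2 where g2: "p2.behavioral g2"
    "\<And>n i a. n < horizon G \<Longrightarrow> i \<in> infos2 G (Suc n) \<Longrightarrow> a \<in> actions2 G (Suc n) \<Longrightarrow>
      plan_of prev2 g2 (n, i, a) = r2 (n, i, a)"
    using p2.plan_induced_by_behavioral[OF r(2)] by blast
  have J: "J G h1 h2 = bilinear_cost G (plan_of prev1 h1) (plan_of prev2 h2)"
    if "p1.behavioral h1" "p2.behavioral h2" for h1 h2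
    using J_eq_bilinear_cost[OF assms] that Suc by (simp add: b1 b2)
  \<comment> \<open>The strategies \<open>g1\<close> and \<open>g2\<close> may be replaced by the
    saddle plans against an arbitrary opposing plan, in particular against the plan of any
    deviation.\<close>
  have eq: "bilinear_cost G (plan_of prev1 g1) q = bilinear_cost G r1 q"
    "bilinear_cost G q' (plan_of prev2 g2) = bilinear_cost G q' r2" for q q'
    using g1(2) g2(2) Suc by (intro bilinear_cost_cong[OF Suc]; simp)+
  have "nash_equilibrium G g1 g2"
    unfolding nash_equilibrium_def b1 b2
    using g1(1) g2(1) J eq max min p1.plan_of_in_plans p2.plan_of_in_plans by simp
  then show ?thesis by blast
qed

end
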